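(* Let $P$ be a poset. The following properties are equivalent: (i) the order on $P$ is the intersection of two scattered linear orders; (ii) (a) $P$ has a non-separating scattered linear extension, and (b) neither $\Omega(\eta)$ nor its dual $\Omega(\eta)^*$ is embeddable in $P$.
   Context: A poset (or its order) is scattered if it contains no induced subposet isomorphic to the chain of rational numbers. A poset is embeddable in another if it is isomorphic to an induced subposet of it. A linear extension $L$ of a poset $P$ is separating if there are $x,y,z\in P$ with $x<_P z$, $y$ incomparable (in $P$) with both $x$ and $z$, and $x<_L y<_L z$; otherwise it is non-separating. $\Omega(\eta)$ is the infinite binary tree in which each level is totally ordered increasingly from left to right: its underlying set is the set of finite $0$-$1$ sequences, and its order is the least order containing the initial-segment order ($s\leq t$ if $s$ is an initial segment of $t$) and, for sequences of equal length, the lexicographic order ($0<1$). Equivalently, $\Omega(\eta)$ is isomorphic to $\{(n,m/2^n): n,m\in\mathbb{N},\ 0\leq m<2^n\}$ ordered by $(n,a)\leq(n',a')$ iff $n\leq n'$ and $a\leq a'$. *)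

theory Defs
  imports Complex_Main "HOL-Library.Sublist"
begin

text \<open>
  A poset is a carrier \<open>A\<close> with a reflexive order relation \<open>r\<close> such that
  \<^term>\<open>partial_order_on A r\<close>; its dual is \<open>(A, r\<inverse>)\<close>.
\<close>

definition poset_embeds :: "'a set \<Rightarrow> 'a rel \<Rightarrow> 'b set \<Rightarrow> 'b rel \<Rightarrow> bool" where
  "poset_embeds A r B s \<longleftrightarrow>
     (\<exists>C f. C \<subseteq> B \<and> bij_betw f A C \<and> (\<forall>x\<in>A. \<forall>y\<in>A. (x, y) \<in> r \<longleftrightarrow> (f x, f y) \<in> s))"

definition scattered :: "'a set \<Rightarrow> 'a rel \<Rightarrow> bool" where
  "scattered A r \<longleftrightarrow> \<not> poset_embeds (UNIV :: rat set) {(p, q). p \<le> q} A r"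

definition linear_extension :: "'a set \<Rightarrow> 'a rel \<Rightarrow> 'a rel \<Rightarrow> bool" where
  "linear_extension A r l \<longleftrightarrow> linear_order_on A l \<and> r \<subseteq> l"

definition strictly_below :: "'a rel \<Rightarrow> 'a \<Rightarrow> 'a \<Rightarrow> bool" where
  "strictly_below r x y \<longleftrightarrow> (x, y) \<in> r \<and> x \<noteq> y"

definition incomparable :: "'a rel \<Rightarrow> 'a \<Rightarrow> 'a \<Rightarrow> bool" where
  "incomparable r x y \<longleftrightarrow> (x, y) \<notin> r \<and> (y, x) \<notin> r"

definition separating :: "'a set \<Rightarrow> 'a rel \<Rightarrow> 'a rel \<Rightarrow> bool" where
  "separating A r l \<longleftrightarrow>
     (\<exists>x\<in>A. \<exists>y\<in>A. \<exists>z\<in>A. strictly_below r x z \<and> incomparable r y x \<and> incomparable r y z \<and>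
        strictly_below l x y \<and> strictly_below l y z)"

text \<open>
  Finite 0-1 sequences are boolean lists, \<^term>\<open>False\<close> standing for 0. The library relation
  \<^const>\<open>lex\<close> is the strict lexicographic order and only relates lists of equal length. That the
  intersection below is itself an order, hence the least one of those intersected, is shown in
  \<open>partial_order_Omega_eta\<close>.
\<close>

definition Omega_eta :: "bool list rel" where
  "Omega_eta = \<Inter> {r. partial_order_on UNIV r \<and> {(s, t). prefix s t} \<subseteq> r \<and>
                       lex {(a, b). a < b} \<subseteq> r}"

lemma lex_length: "(s, t) \<in> lex r \<Longrightarrow> length s = length t"
  by (simp add: lex_conv)

lemma lex_less_trans:
  assumes "(s, t) \<in> lex {(a, b). a < b}" "(t, u) \<in> lex {(a, b). a < b}"
  shows "(s, u) \<in> lex {(a :: bool, b). a < b}"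
  using assms
proof (induction s arbitrary: t u)
  case (Cons a s)
  then show ?case by (cases t; cases u) (auto dest: lex_length)
qed simp

lemma lex_less_antisym:
  "(s, t) \<in> lex {(a, b). a < b} \<Longrightarrow> (t, s) \<notin> lex {(a :: bool, b). a < b}"
proof (induction s arbitrary: t)
  case (Cons a s)
  then show ?case by (cases t) auto
qed simp

lemma lex_less_take:
  "(s, t) \<in> lex {(a, b). a < b} \<Longrightarrow>
     take n s = take n t \<or> (take n s, take n t) \<in> lex {(a :: bool, b). a < b}"
proof (induction s arbitrary: t n)
  case (Cons a s)
  then obtain b t' where t: "t = b # t'" by (cases t) auto
  with Cons.prems have "length s = length t'" by (auto dest: lex_length)
  then have "length (take m s) = length (take m t')" for m by simp
  with Cons t show ?case by (cases n) auto
qed simp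

lemma Omega_eta_iff:
  "(s, t) \<in> Omega_eta \<longleftrightarrow> length s \<le> length t \<and>
     (s = take (length s) t \<or> (s, take (length s) t) \<in> lex {(a, b). a < b})"
  and partial_order_Omega_eta: "partial_order_on UNIV Omega_eta"
proof -
  let ?L = "lex {(a :: bool, b). a < b}"
  let ?Q = "{(s, t). length s \<le> length t \<and> (s = take (length s) t \<or> (s, take (length s) t) \<in> ?L)}"
  have "trans ?Q"
  proof (rule transI)
    fix s t u
    assume st: "(s, t) \<in> ?Q" and tu: "(t, u) \<in> ?Q"
    let ?n = "length s"
    let ?m = "length t"
    from st have nm: "?n \<le> ?m" and st': "s = take ?n t \<or> (s, take ?n t) \<in> ?L"
      by blast+
    from tu have mk: "?m \<le> length u" and tu': "t = take ?m u \<or> (t, take ?m u) \<in> ?L"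
      by blast+
    have "take ?n (take ?m u) = take ?n u"
      using nm by (simp add: min_absorb1)
    then have "take ?n t = take ?n u \<or> (take ?n t, take ?n u) \<in> ?L"
      using tu' lex_less_take[of t "take ?m u" ?n] by metis
    then have "s = take ?n u \<or> (s, take ?n u) \<in> ?L"
      using st' lex_less_trans by metis
    with nm mk show "(s, u) \<in> ?Q"
      by (simp only: mem_Collect_eq prod.case) (meson order_trans)
  qed
  moreover have "antisym ?Q"
  proof (rule antisymI)
    fix s t
    assume st: "(s, t) \<in> ?Q" and ts: "(t, s) \<in> ?Q"
    then have "length s = length t"
      by (simp only: mem_Collect_eq prod.case) (meson order_antisym)
    with st ts have "s = t \<or> (s, t) \<in> ?L" "t = s \<or> (t, s) \<in> ?L"
      by simp_all
    then show "s = t"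
      using lex_less_antisym by blast
  qed
  moreover have "refl ?Q"
    by (auto simp: refl_on_def)
  ultimately have order: "partial_order_on UNIV ?Q"
    by (simp add: partial_order_on_def preorder_on_def)
  have "?L \<subseteq> ?Q"
  proof (rule subrelI)
    fix s t
    assume st: "(s, t) \<in> ?L"
    then have "length s = length t" by (rule lex_length)
    with st show "(s, t) \<in> ?Q" by simp
  qed
  moreover have "{(s, t). prefix s t} \<subseteq> ?Q"
    by (auto elim!: prefixE)
  ultimately have "Omega_eta \<subseteq> ?Q"
    using order unfolding Omega_eta_def by blast
  moreover have "(s, t) \<in> r" if "(s, t) \<in> ?Q" and r: "partial_order_on UNIV r"
    "{(s, t). prefix s t} \<subseteq> r" "?L \<subseteq> r" for s t r
  proof -
    have "(s, take (length s) t) \<in> r"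
      using that(1) r(3) partial_order_onD(1)[OF r(1)] by (auto simp only: mem_Collect_eq prod.case refl_onD UNIV_I subset_iff)
    moreover have "(take (length s) t, t) \<in> r"
      using r(2) take_is_prefix[of "length s" t] by blast
    ultimately show ?thesis
      using r(1) by (meson partial_order_onD(2) transD)
  qed
  then have "?Q \<subseteq> Omega_eta"
    unfolding Omega_eta_def by blast
  ultimately have eq: "Omega_eta = ?Q" by blast
  then show "(s, t) \<in> Omega_eta \<longleftrightarrow> length s \<le> length t \<and>
     (s = take (length s) t \<or> (s, take (length s) t) \<in> ?L)" by auto
  from eq order show "partial_order_on UNIV Omega_eta" by simp
qed

end

theory Submission
  imports Defs "HOL-Library.Countable"
begin

text \<open>
  For a non-separating extension \<open>L\<close> of \<open>P\<close>, reversing \<open>L\<close> on the incomparable pairs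
  gives a linear order \<open>L2\<close> with \<open>P = L \<inter> L2\<close>. Suppose that \<open>L\<close> is scattered and \<open>L2\<close>
  is not. If every \<open>L2\<close>-nonscattered set had a point splitting it along \<open>L\<close> into two
  \<open>L2\<close>-nonscattered halves, iterating would embed the rationals into \<open>L\<close>. As a union of two
  scattered sets is scattered, there is therefore an \<open>L2\<close>-nonscattered \<open>T\<close> all of whose initial
  (or all of whose final) \<open>L\<close>-segments are \<open>L2\<close>-scattered. Inside \<open>T\<close>, any
  \<open>L2\<close>-interval of a dense subset has points arbitrarily far along \<open>L\<close>, so the nodes of
  \<open>\<Omega>(\<eta>)\<close> (or its dual) can be placed level by level.

  Conversely, \<open>\<Omega>(\<eta>)\<close> has essentially one realizer, because its incomparability graph has only
  one transitive orientation up to reversal; one of its two linear orders sorts the nodes by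
  their dyadic value and so is not scattered.
\<close>

section \<open>Scattered orders and dense subsets\<close>

text \<open>A stand-in for containing a copy of the rationals, with which it agrees on linear orders
  by \<open>scattered_iff\<close>. Speaking of density alone, it passes easily to supersets, unions
  and the converse order.\<close>

definition contains_dense :: "'a rel \<Rightarrow> 'a set \<Rightarrow> bool" where
  "contains_dense r X \<longleftrightarrow>
     (\<exists>D\<subseteq>X. (\<exists>a\<in>D. \<exists>b\<in>D. strictly_below r a b) \<and>
        (\<forall>a\<in>D. \<forall>b\<in>D. strictly_below r a b \<longrightarrow>
           (\<exists>c\<in>D. strictly_below r a c \<and> strictly_below r c b)))"

lemma contains_denseI:
  assumes "D \<subseteq> X" "a \<in> D" "b \<in> D" "strictly_below r a b"
    "\<And>a b. a \<in> D \<Longrightarrow> b \<in> D \<Longrightarrow> strictly_below r a b \<Longrightarrow>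
       \<exists>c\<in>D. strictly_below r a c \<and> strictly_below r c b"
  shows "contains_dense r X"
  using assms unfolding contains_dense_def by blast

lemma contains_dense_mono: "contains_dense r X \<Longrightarrow> X \<subseteq> Y \<Longrightarrow> contains_dense r Y"
  unfolding contains_dense_def by (meson order_trans)

lemma not_contains_dense_empty: "\<not> contains_dense r {}"
  unfolding contains_dense_def by blast

lemma strictly_below_converse: "strictly_below (r\<inverse>) x y \<longleftrightarrow> strictly_below r y x"
  unfolding strictly_below_def by auto

lemma contains_dense_converse: "contains_dense (r\<inverse>) X \<longleftrightarrow> contains_dense r X"
  unfolding contains_dense_def strictly_below_converse by meson

lemma linear_order_onD:
  assumes "linear_order_on A r"
  shows "(x, y) \<in> r \<Longrightarrow> x \<in> A" "(x, y) \<in> r \<Longrightarrow> y \<in> A" "x \<in> A \<Longrightarrow> (x, x) \<in> r"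
    "(x, y) \<in> r \<Longrightarrow> (y, z) \<in> r \<Longrightarrow> (x, z) \<in> r"
    "(x, y) \<in> r \<Longrightarrow> (y, x) \<in> r \<Longrightarrow> x = y"
    "x \<in> A \<Longrightarrow> y \<in> A \<Longrightarrow> (x, y) \<in> r \<or> (y, x) \<in> r"
  using assms unfolding order_on_defs
  by (auto simp: refl_on_def elim: transE dest: antisymD) (metis total_on_def)

lemma strictly_below_trans:
  assumes "linear_order_on A r" "strictly_below r x y" "strictly_below r y z"
  shows "strictly_below r x z"
  using assms linear_order_onD(4,5)[OF assms(1)] unfolding strictly_below_def by blast

text \<open>Either \<open>X\<close> meets every interval of the dense set \<open>D\<close>, and then
  \<open>D \<inter> X\<close> is dense, or some interval of \<open>D\<close> misses \<open>X\<close>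
  and is a dense part of \<open>Y\<close>.\<close>

lemma contains_dense_Un:
  assumes r: "linear_order_on A r" and XY: "contains_dense r (X \<union> Y)"
  shows "contains_dense r X \<or> contains_dense r Y"
proof -
  note tr = strictly_below_trans[OF r]
  from XY obtain D a0 b0 where D: "D \<subseteq> X \<union> Y" and ab0: "a0 \<in> D" "b0 \<in> D" "strictly_below r a0 b0"
    and dense: "\<And>a b. a \<in> D \<Longrightarrow> b \<in> D \<Longrightarrow> strictly_below r a b \<Longrightarrow>
       \<exists>c\<in>D. strictly_below r a c \<and> strictly_below r c b"
    unfolding contains_dense_def by blast
  show ?thesis
  proof (cases "\<forall>a\<in>D. \<forall>b\<in>D. strictly_below r a b \<longrightarrow>
      (\<exists>c\<in>D \<inter> X. strictly_below r a c \<and> strictly_below r c b)")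
    case True
    then obtain c where c: "c \<in> D \<inter> X" "strictly_below r a0 c" "strictly_below r c b0"
      using ab0 by blast
    then obtain d where d: "d \<in> D \<inter> X" "strictly_below r c d"
      using True ab0 by blast
    have "contains_dense r X"
      by (rule contains_denseI[of "D \<inter> X" _ c d]) (use True c d in blast)+
    then show ?thesis ..
  next
    case False
    then obtain a b where ab: "a \<in> D" "b \<in> D" "strictly_below r a b"
      and no: "\<And>c. c \<in> D \<Longrightarrow> c \<in> X \<Longrightarrow> strictly_below r a c \<Longrightarrow> \<not> strictly_below r c b" by blast
    let ?E = "{c\<in>D. strictly_below r a c \<and> strictly_below r c b}"
    obtain c where c: "c \<in> ?E" using dense ab by blast
    moreover then obtain d where d: "d \<in> D" "strictly_below r c d" "strictly_below r d b"
      using dense ab by blast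
    moreover have "d \<in> ?E" using c d tr by blast
    moreover have "?E \<subseteq> Y" using no D by blast
    moreover have "\<exists>z\<in>?E. strictly_below r x z \<and> strictly_below r z y"
      if xy: "x \<in> ?E" "y \<in> ?E" "strictly_below r x y" for x y
    proof -
      obtain z where "z \<in> D" "strictly_below r x z" "strictly_below r z y"
        using dense xy by blast
      with xy tr show ?thesis by blast
    qed
    ultimately have "contains_dense r Y"
      by (intro contains_denseI[of ?E _ c d]) auto
    then show ?thesis ..
  qed
qed

lemma contains_dense_UN:
  assumes "linear_order_on A r" "finite F" "contains_dense r (\<Union>c\<in>F. X c)"
  shows "\<exists>c\<in>F. contains_dense r (X c)"
  using assms(2,3)
proof (induction F)
  case (insert c F)
  then have "contains_dense r (X c \<union> (\<Union>c\<in>F. X c))" by simp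
  with contains_dense_Un[OF assms(1) this] insert show ?case by auto
qed (simp add: not_contains_dense_empty)

section \<open>Sequences from the forth argument\<close>

lemma finite_chain_max:
  assumes "finite F" "F \<noteq> {}" "\<And>x y. x \<in> F \<Longrightarrow> y \<in> F \<Longrightarrow> x = y \<or> lt x y \<or> lt y x"
    "\<And>x y z. lt x y \<Longrightarrow> lt y z \<Longrightarrow> lt x z"
  shows "\<exists>m\<in>F. \<forall>x\<in>F. x = m \<or> lt x m"
  using assms(1-3)
proof (induction F rule: finite_ne_induct)
  case (insert x F)
  then obtain m where "m \<in> F" "\<forall>y\<in>F. y = m \<or> lt y m" by blast
  moreover from this(1) insert.prems have "x = m \<or> lt x m \<or> lt m x" by blast
  ultimately show ?case using assms(4) by (metis insert_iff)
qed simp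

text \<open>
  The forth half of Cantor's back-and-forth argument: the order of the indices by \<open>k\<close>, ties being broken
  by the natural order, is realised by \<open>lt\<close>, and the natural order itself by \<open>R\<close>.
\<close>

lemma dense_sequence:
  fixes lt R :: "'b \<Rightarrow> 'b \<Rightarrow> bool" and k :: "nat \<Rightarrow> 'c::linorder"
  assumes tr: "\<And>x y z. lt x y \<Longrightarrow> lt y z \<Longrightarrow> lt x z"
    and ab0: "a0 \<in> D" "b0 \<in> D" "lt a0 b0"
    and dense: "\<And>F a b. finite F \<Longrightarrow> F \<subseteq> D \<Longrightarrow> a \<in> D \<Longrightarrow> b \<in> D \<Longrightarrow> lt a b \<Longrightarrow>
       \<exists>x\<in>D. lt a x \<and> lt x b \<and> (\<forall>c\<in>F. R c x)"
  obtains g where "\<And>n. g n \<in> D" "\<And>i j. i < j \<Longrightarrow> R (g i) (g j)"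
    "\<And>i j. i < j \<Longrightarrow> k i \<le> k j \<Longrightarrow> lt (g i) (g j)"
    "\<And>i j. i < j \<Longrightarrow> k j < k i \<Longrightarrow> lt (g j) (g i)"
proof -
  \<comment> \<open>\<open>good f n x\<close> admits \<open>x\<close> as term \<open>n\<close> after
    the terms of \<open>f\<close> before \<open>n\<close>. The bounds \<open>a0\<close> and
    \<open>b0\<close> leave room below and above all terms.\<close>
  define good where "good f n x \<longleftrightarrow> x \<in> D \<and> lt a0 x \<and> lt x b0 \<and>
     (\<forall>i<n. R (f i) x \<and> (if k i \<le> k n then lt (f i) x else lt x (f i)))" for f n x
  have "\<exists>g. \<forall>n. good g n (g n)"
  proof (rule dependent_wf_choice[OF wf_less])
    show "good f n x = good g n x" if "\<And>i. (i, n) \<in> {(x, y). x < y} \<Longrightarrow> f i = g i" for f g n x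
      using that unfolding good_def by simp
    fix n f
    assume "\<And>i. (i, n) \<in> {(x, y). x < y} \<Longrightarrow> good f i (f i)"
    then have good: "good f i (f i)" if "i < n" for i using that by simp
    \<comment> \<open>The new term goes between the greatest element of \<open>?lo\<close> and the
      least of \<open>?hi\<close>; \<open>a0\<close> and \<open>b0\<close> keep both sets
      nonempty.\<close>
    let ?lo = "insert a0 (f ` {i. i < n \<and> k i \<le> k n})"
    let ?hi = "insert b0 (f ` {i. i < n \<and> k n < k i})"
    have comp: "i = j \<or> lt (f i) (f j) \<or> lt (f j) (f i)" if "i < n" "j < n" for i j
      using good[OF that(1)] good[OF that(2)] unfolding good_def by (metis linorder_neqE_nat)
    have "\<exists>m\<in>?lo. \<forall>x\<in>?lo. x = m \<or> lt x m"
    proof (rule finite_chain_max)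
      show "x = y \<or> lt x y \<or> lt y x" if "x \<in> ?lo" "y \<in> ?lo" for x y
        using that comp good unfolding good_def by blast
    qed (use tr in auto)
    then obtain a where a: "a \<in> ?lo" "\<And>x. x \<in> ?lo \<Longrightarrow> x = a \<or> lt x a" by blast
    have "\<exists>m\<in>?hi. \<forall>x\<in>?hi. x = m \<or> lt m x"
    proof (rule finite_chain_max[where lt = "\<lambda>x y. lt y x"])
      show "x = y \<or> lt y x \<or> lt x y" if "x \<in> ?hi" "y \<in> ?hi" for x y
        using that comp good unfolding good_def by blast
    qed (use tr in auto)
    then obtain b where b: "b \<in> ?hi" "\<And>x. x \<in> ?hi \<Longrightarrow> x = b \<or> lt b x" by blast
    have "lt (f i) (f j)" if "i < n" "j < n" "k i \<le> k n" "k n < k j" for i j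
    proof -
      have "k i < k j" using that by simp
      moreover from this have "i \<noteq> j" by auto
      ultimately show ?thesis
        using good[OF that(1)] good[OF that(2)] unfolding good_def
        by (metis linorder_neqE_nat not_less order.strict_implies_order)
    qed
    then have "lt a b" using a(1) b(1) ab0 good unfolding good_def by blast
    moreover have "a \<in> D" "b \<in> D" "f ` {..<n} \<subseteq> D"
      using a(1) b(1) ab0 good unfolding good_def by blast+
    ultimately obtain x where x: "x \<in> D" "lt a x" "lt x b" "\<forall>c\<in>f ` {..<n}. R c x"
      using dense[of "f ` {..<n}" a b] by blast
    have "lt y x" if "y \<in> ?lo" for y using a(2)[OF that] x(2) tr by blast
    moreover have "lt x y" if "y \<in> ?hi" for y using b(2)[OF that] x(3) tr by blast
    ultimately have "good f n x" using x(1,4) unfolding good_def by auto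
    then show "\<exists>x. good f n x" ..
  qed
  then obtain g where "\<And>n. good g n (g n)" by blast
  then show thesis by (intro that[of g]) (simp_all add: good_def not_le[symmetric])
qed

text \<open>Injectivity is a consequence: by reflexivity of \<open>s\<close>, points with equal
  images are related both ways, and antisymmetry of \<open>r\<close> identifies them.\<close>

lemma poset_embedsI:
  assumes "partial_order_on A r" "refl_on B s" "f ` A \<subseteq> B"
    "\<And>x y. x \<in> A \<Longrightarrow> y \<in> A \<Longrightarrow> (x, y) \<in> r \<longleftrightarrow> (f x, f y) \<in> s"
  shows "poset_embeds A r B s"
proof -
  have "inj_on f A"
  proof (rule inj_onI)
    fix x y assume xy: "x \<in> A" "y \<in> A" "f x = f y"
    then have "(f x, f y) \<in> s" "(f y, f x) \<in> s"
      using assms(2,3) by (auto simp: refl_on_def)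
    with xy assms(4) have "(x, y) \<in> r" "(y, x) \<in> r" by blast+
    with assms(1) show "x = y" unfolding partial_order_on_def by (meson antisymD)
  qed
  then show ?thesis
    using assms(3,4) unfolding poset_embeds_def by (blast intro: inj_on_imp_bij_betw)
qed

lemma poset_embedsE:
  assumes "poset_embeds A r B s"
  obtains f where "inj_on f A" "f ` A \<subseteq> B"
    "\<And>x y. x \<in> A \<Longrightarrow> y \<in> A \<Longrightarrow> (x, y) \<in> r \<longleftrightarrow> (f x, f y) \<in> s"
  using assms unfolding poset_embeds_def bij_betw_def by blast

lemma poset_embeds_converse: "poset_embeds A (r\<inverse>) B (s\<inverse>) \<longleftrightarrow> poset_embeds A r B s"
  unfolding poset_embeds_def converse_iff by meson

lemma partial_order_le: "partial_order_on UNIV {(p, q). p \<le> (q :: 'a::order)}"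
  by (auto simp: order_on_defs refl_on_def intro: transI antisymI)

lemma strictly_increasing_not_scattered:
  fixes h :: "rat \<Rightarrow> 'a"
  assumes r: "linear_order_on A r" and hA: "range h \<subseteq> A"
    and h: "\<And>p q. p < q \<Longrightarrow> strictly_below r (h p) (h q)"
  shows "\<not> scattered A r"
proof -
  have "p \<le> q \<longleftrightarrow> (h p, h q) \<in> r" for p q
  proof (cases p q rule: linorder_cases)
    case equal
    then show ?thesis using linear_order_onD(3)[OF r] hA by auto
  qed (use h[of p q] h[of q p] linear_order_onD(5)[OF r] in \<open>auto simp: strictly_below_def\<close>)
  moreover have "refl_on A r" using r by (simp add: order_on_defs)
  ultimately show ?thesis
    using hA unfolding scattered_def by (auto intro!: poset_embedsI partial_order_le)
qed

text \<open>\<open>lt\<close> may be a proper part of the strict order. The forth argument, with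
  each index keyed by the rational it codes and \<open>R\<close> trivial, makes the terms at codes
  of rationals increase under \<open>lt\<close>.\<close>

lemma dense_relation_not_scattered:
  assumes r: "linear_order_on A r"
    and tr: "\<And>x y z. lt x y \<Longrightarrow> lt y z \<Longrightarrow> lt x z"
    and sub: "\<And>x y. lt x y \<Longrightarrow> strictly_below r x y"
    and D: "D \<subseteq> A" "a0 \<in> D" "b0 \<in> D" "lt a0 b0"
    and dense: "\<And>a b. a \<in> D \<Longrightarrow> b \<in> D \<Longrightarrow> lt a b \<Longrightarrow> \<exists>c\<in>D. lt a c \<and> lt c b"
  shows "\<not> scattered A r"
proof -
  obtain g where gD: "\<And>n. g n \<in> D"
    and g: "\<And>i j. i < j \<Longrightarrow> (from_nat i :: rat) \<le> from_nat j \<Longrightarrow> lt (g i) (g j)"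
      "\<And>i j. i < j \<Longrightarrow> (from_nat j :: rat) < from_nat i \<Longrightarrow> lt (g j) (g i)"
  proof (rule dense_sequence[of lt a0 D b0 "\<lambda>_ _. True" "from_nat :: nat \<Rightarrow> rat"])
    show "lt x z" if "lt x y" "lt y z" for x y z using tr that .
    show "\<exists>x\<in>D. lt a x \<and> lt x b \<and> (\<forall>c\<in>F. True)" if "a \<in> D" "b \<in> D" "lt a b" for F a b
      using dense[OF that] by simp
  qed (use D in auto)
  have "lt (g (to_nat p)) (g (to_nat q))" if "p < q" for p q :: rat
    using g[of "to_nat p" "to_nat q"] g[of "to_nat q" "to_nat p"] that
    by (metis from_nat_to_nat less_imp_le linorder_neqE_nat order_less_irrefl)
  then show ?thesis
    by (intro strictly_increasing_not_scattered[OF r, of "\<lambda>q. g (to_nat q)"]) (use gD D(1) sub in auto)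
qed

lemma scattered_iff:
  assumes r: "linear_order_on A r"
  shows "scattered A r \<longleftrightarrow> \<not> contains_dense r A"
proof
  assume scat: "scattered A r"
  show "\<not> contains_dense r A"
  proof
    assume "contains_dense r A"
    then obtain D a b where D: "D \<subseteq> A" "a \<in> D" "b \<in> D" "strictly_below r a b"
      and dense: "\<And>a b. a \<in> D \<Longrightarrow> b \<in> D \<Longrightarrow> strictly_below r a b \<Longrightarrow>
         \<exists>c\<in>D. strictly_below r a c \<and> strictly_below r c b"
      unfolding contains_dense_def by blast
    have "\<not> scattered A r"
    proof (rule dense_relation_not_scattered[OF r, of "strictly_below r" D a b])
      show "strictly_below r x z" if "strictly_below r x y" "strictly_below r y z" for x y z
        using strictly_below_trans[OF r that] .
    qed (use D dense in auto)
    with scat show False by blast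
  qed
next
  assume no: "\<not> contains_dense r A"
  show "scattered A r"
    unfolding scattered_def
  proof
    assume "poset_embeds (UNIV :: rat set) {(p, q). p \<le> q} A r"
    then obtain f where f: "inj f" "range f \<subseteq> A" "\<And>p q :: rat. p \<le> q \<longleftrightarrow> (f p, f q) \<in> r"
      by (elim poset_embedsE) auto
    then have sb: "strictly_below r (f p) (f q) \<longleftrightarrow> p < q" for p q
      unfolding strictly_below_def by (auto simp: inj_eq less_le)
    have "contains_dense r A"
      by (rule contains_denseI[OF f(2), of "f 0" "f 1"]) (auto simp: sb intro: dense)
    with no show False ..
  qed
qed

lemma scattered_converse: "linear_order_on A r \<Longrightarrow> scattered A (r\<inverse>) \<longleftrightarrow> scattered A r"
  by (simp add: scattered_iff contains_dense_converse)

section \<open>The value of a node of the binary tree\<close>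

text \<open>The binary fraction \<open>0.s\<close>: the node \<open>s\<close> is the pair \<open>(length s, val s)\<close> of the second
  description of \<open>\<Omega>(\<eta>)\<close>.\<close>

fun val :: "bool list \<Rightarrow> real" where
  "val [] = 0"
| "val (b # s) = (of_bool b + val s) / 2"

text \<open>The number with binary digits \<open>1 s\<close>, which enumerates the nodes level by level.\<close>

fun idx :: "bool list \<Rightarrow> nat" where
  "idx [] = 1"
| "idx (b # s) = (if b then 2 else 1) * 2 ^ length s + idx s"

lemma val_nonneg: "0 \<le> val s"
  by (induction s) auto

lemma val_le: "val s \<le> 1 - 1 / 2 ^ length s"
proof (induction s)
  case (Cons b s)
  have "(of_bool b + val s) / 2 \<le> (1 + (1 - 1 / 2 ^ length s)) / 2"
    using Cons.IH by (intro divide_right_mono add_mono) auto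
  then show ?case by (simp add: diff_divide_distrib)
qed simp

lemma val_less_1: "val s < 1"
  by (rule le_less_trans[OF val_le]) simp

lemma val_replicate: "val (replicate n b) = (if b then 1 - 1 / 2 ^ n else 0)"
  by (induction n) (auto simp: field_simps)

lemma val_append: "val (s @ t) = val s + val t / 2 ^ length s"
  by (induction s) (auto simp: field_simps)

text \<open>Appending \<open>n\<close> zeros and a one to \<open>s\<close> raises its value by a
  positive amount, which is below \<open>val t - val s\<close> for large \<open>n\<close>.\<close>

lemma val_dense:
  assumes "val s < val t"
  obtains u where "val s < val u" "val u < val t"
proof -
  obtain n where n: "(1 / 2) ^ n < val t - val s"
    using real_arch_pow_inv[of "val t - val s" "1 / 2"] assms by auto
  let ?u = "s @ replicate n False @ [True]"
  have u: "val ?u = val s + 1 / 2 ^ (length s + n + 1)"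
    by (simp add: val_append val_replicate power_add field_simps)
  have "1 / 2 ^ (length s + n + 1) \<le> (1 / 2 :: real) ^ n"
    unfolding power_one_over by (intro divide_left_mono power_increasing) auto
  with n have "val ?u < val t" unfolding u by linarith
  moreover have "val s < val ?u" unfolding u by simp
  ultimately show thesis using that by blast
qed

section \<open>The tree order in terms of length, value and index\<close>

lemma Omega_eta_Nil: "([], t) \<in> Omega_eta"
  by (simp add: Omega_eta_iff)

lemma Omega_eta_Cons:
  "(a # s, b # t) \<in> Omega_eta \<longleftrightarrow>
     a = b \<and> (s, t) \<in> Omega_eta \<or> a < b \<and> length s \<le> length t"
  by (auto simp: Omega_eta_iff)

text \<open>Induction on the digits: tails have values in the half-open unit interval, so differing
  first digits already decide the comparison of values.\<close>

lemma Omega_eta_val: "(s, t) \<in> Omega_eta \<longleftrightarrow> length s \<le> length t \<and> val s \<le> val t"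
proof (induction s arbitrary: t)
  case Nil
  then show ?case by (simp add: Omega_eta_Nil val_nonneg)
next
  case (Cons a s)
  show ?case
  proof (cases t)
    case Nil
    then show ?thesis by (simp add: Omega_eta_iff)
  next
    case t: (Cons b t')
    show ?thesis
      using val_nonneg[of s] val_less_1[of s] val_nonneg[of t'] val_less_1[of t']
      unfolding t Omega_eta_Cons Cons.IH by (cases a; cases b) auto
  qed
qed

lemma idx_val: "real (idx s) = 2 ^ length s * (1 + val s)"
  by (induction s) (auto simp: field_simps)

lemma idx_bounds: "2 ^ length s \<le> idx s" "idx s < 2 ^ Suc (length s)"
proof -
  have "real (2 ^ length s) \<le> real (idx s)" "real (idx s) < real (2 ^ Suc (length s))"
    unfolding idx_val using val_nonneg[of s] val_less_1[of s] by (auto simp: field_simps)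
  then show "2 ^ length s \<le> idx s" "idx s < 2 ^ Suc (length s)"
    by (simp_all only: of_nat_le_iff of_nat_less_iff)
qed

lemma idx_le_length: "idx s \<le> idx t \<Longrightarrow> length s \<le> length t"
proof (rule ccontr)
  assume "idx s \<le> idx t" "\<not> length s \<le> length t"
  then have "2 ^ Suc (length t) \<le> (2::nat) ^ length s" by (intro power_increasing) auto
  with idx_bounds[of s] idx_bounds[of t] \<open>idx s \<le> idx t\<close> show False by linarith
qed

lemma idx_mono_length: "length s < length t \<Longrightarrow> idx s < idx t"
  using idx_le_length not_less by blast

text \<open>Across levels \<open>idx\<close> follows the length, within a level it follows
  \<open>val\<close>. As \<open>idx\<close> is injective, the nodes can be placed one after another
  in this order.\<close>

lemma Omega_eta_idx: "(s, t) \<in> Omega_eta \<longleftrightarrow> idx s \<le> idx t \<and> val s \<le> val t"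
proof -
  have "idx s \<le> idx t" if "length s \<le> length t" "val s \<le> val t"
  proof (cases "length s = length t")
    case True
    then have "real (idx s) \<le> real (idx t)" using that(2) unfolding idx_val by simp
    then show ?thesis by simp
  qed (use that(1) idx_mono_length[of s t] in simp)
  then show ?thesis unfolding Omega_eta_val using idx_le_length by blast
qed

lemma inj_idx: "inj idx"
proof (rule injI)
  fix s t assume eq: "idx s = idx t"
  then have "length s = length t" using idx_le_length[of s t] idx_le_length[of t s] by simp
  with eq idx_val[of s] idx_val[of t] have "val s = val t" by simp
  with eq have "(s, t) \<in> Omega_eta" "(t, s) \<in> Omega_eta" by (simp_all add: Omega_eta_idx)
  then show "s = t"
    using partial_order_Omega_eta unfolding partial_order_on_def by (meson antisymD)
qed

section \<open>Embedding the tree into an intersection\<close>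

text \<open>Nodes are placed in the order of \<open>idx\<close>, each beyond all earlier ones along
  \<open>L\<close>, while their position along \<open>Q\<close> follows \<open>val\<close>.\<close>

lemma Omega_eta_embeds:
  assumes L: "linear_order_on A L" and Q: "linear_order_on A Q" and T: "T \<subseteq> A"
    and dense: "contains_dense Q T"
    and initial: "\<And>c. c \<in> T \<Longrightarrow> \<not> contains_dense Q {x\<in>T. (x, c) \<in> L}"
  shows "poset_embeds UNIV Omega_eta A (L \<inter> Q)"
proof -
  note trQ = strictly_below_trans[OF Q]
  from dense obtain D a0 b0 where D: "D \<subseteq> T" "a0 \<in> D" "b0 \<in> D" "strictly_below Q a0 b0"
    and Dd: "\<And>a b. a \<in> D \<Longrightarrow> b \<in> D \<Longrightarrow> strictly_below Q a b \<Longrightarrow>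
       \<exists>c\<in>D. strictly_below Q a c \<and> strictly_below Q c b"
    unfolding contains_dense_def by blast
  \<comment> \<open>Otherwise finitely many initial \<open>L\<close>-segments of \<open>T\<close>
    would cover a \<open>Q\<close>-interval of \<open>D\<close>. That interval contains a dense set,
    so by \<open>contains_dense_UN\<close> one of the segments would too.\<close>
  have far: "\<exists>x\<in>D. strictly_below Q a x \<and> strictly_below Q x b \<and> (\<forall>c\<in>F. strictly_below L c x)"
    if F: "finite F" "F \<subseteq> D" and ab: "a \<in> D" "b \<in> D" "strictly_below Q a b" for F a b
  proof (rule ccontr)
    assume no: "\<not> ?thesis"
    let ?I = "{x\<in>D. strictly_below Q a x \<and> strictly_below Q x b}"
    have "contains_dense Q ?I"
    proof -
      obtain c where c: "c \<in> D" "strictly_below Q a c" "strictly_below Q c b" using Dd ab by blast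
      then obtain d where d: "d \<in> D" "strictly_below Q c d" "strictly_below Q d b"
        using Dd ab by blast
      show ?thesis
      proof (rule contains_denseI[of ?I _ c d])
        fix x y assume xy: "x \<in> ?I" "y \<in> ?I" "strictly_below Q x y"
        then obtain z where "z \<in> D" "strictly_below Q x z" "strictly_below Q z y"
          using Dd by blast
        with xy trQ show "\<exists>z\<in>?I. strictly_below Q x z \<and> strictly_below Q z y" by blast
      qed (use c d trQ in blast)+
    qed
    moreover have "?I \<subseteq> (\<Union>c\<in>F. {x\<in>T. (x, c) \<in> L})"
    proof
      fix x assume x: "x \<in> ?I"
      with no obtain c where c: "c \<in> F" "\<not> strictly_below L c x" by blast
      then have "(x, c) \<in> L"
        using linear_order_onD(3,6)[OF L] x D(1) T F(2) unfolding strictly_below_def by blast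
      with c x D(1) show "x \<in> (\<Union>c\<in>F. {x\<in>T. (x, c) \<in> L})" by blast
    qed
    ultimately have "contains_dense Q (\<Union>c\<in>F. {x\<in>T. (x, c) \<in> L})" by (rule contains_dense_mono)
    from contains_dense_UN[OF Q F(1) this] initial F(2) D(1) show False by blast
  qed
  \<comment> \<open>Since \<open>idx\<close> starts at 1, the key of index 0 is arbitrary; the
    embedding reads only the terms \<open>g (idx s)\<close>. Of two distinct nodes with equal value
    the shorter is below in the tree, as the tie-breaking requires.\<close>
  obtain g where gD: "\<And>n. g n \<in> D"
    and gL: "\<And>i j. i < j \<Longrightarrow> strictly_below L (g i) (g j)"
    and g1: "\<And>i j. i < j \<Longrightarrow> val (inv idx i) \<le> val (inv idx j) \<Longrightarrow> strictly_below Q (g i) (g j)"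
    and g2: "\<And>i j. i < j \<Longrightarrow> val (inv idx j) < val (inv idx i) \<Longrightarrow> strictly_below Q (g j) (g i)"
    using dense_sequence[of "strictly_below Q" a0 D b0 "strictly_below L" "\<lambda>i. val (inv idx i)"]
      trQ D(2-4) far by blast
  have gA: "g n \<in> A" for n using gD D(1) T by blast
  have gL': "(g i, g j) \<in> L \<longleftrightarrow> i \<le> j" for i j
    using gL[of i j] gL[of j i] linear_order_onD(3,5)[OF L] gA unfolding strictly_below_def
    by (metis less_imp_le linorder_neqE_nat not_le order_refl)
  show ?thesis
  proof (rule poset_embedsI[OF partial_order_Omega_eta])
    show "refl_on A (L \<inter> Q)" using L Q by (auto simp: order_on_defs refl_on_def)
    show "range (\<lambda>s. g (idx s)) \<subseteq> A" using gA by blast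
    fix s t
    have "(g (idx s), g (idx t)) \<in> Q \<longleftrightarrow> val s \<le> val t" if "idx s \<le> idx t"
    proof (cases "idx s = idx t")
      case True
      then have "s = t" using inj_idx by (simp add: inj_eq)
      then show ?thesis using linear_order_onD(3)[OF Q] gA by simp
    next
      case False
      with that have "idx s < idx t" by simp
      from g1[OF this] g2[OF this] show ?thesis
        using linear_order_onD(5)[OF Q] unfolding strictly_below_def inv_f_f[OF inj_idx]
        by (meson linorder_not_le)
    qed
    then show "(s, t) \<in> Omega_eta \<longleftrightarrow> (g (idx s), g (idx t)) \<in> L \<inter> Q"
      unfolding Omega_eta_idx Int_iff gL' by blast
  qed
qed

text \<open>Relate \<open>x\<close> to \<open>y\<close> when the open \<open>L\<close>-interval
  between them is non-scattered for \<open>Q\<close>. Splitting that interval makes this part of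
  \<open>L\<close> dense.\<close>

lemma not_scattered_if_splitting:
  assumes L: "linear_order_on A L" and Q: "linear_order_on A Q" and A: "contains_dense Q A"
    and split: "\<And>T. T \<subseteq> A \<Longrightarrow> contains_dense Q T \<Longrightarrow> \<exists>c\<in>T.
       contains_dense Q {x\<in>T. strictly_below L x c} \<and> contains_dense Q {x\<in>T. strictly_below L c x}"
  shows "\<not> scattered A L"
proof -
  define I where "I x y = {z\<in>A. strictly_below L x z \<and> strictly_below L z y}" for x y
  define lt where "lt x y \<longleftrightarrow> strictly_below L x y \<and> contains_dense Q (I x y)" for x y
  note trL = strictly_below_trans[OF L]
  \<comment> \<open>Two splittings give a first related pair: \<open>d\<close> splits the part above
    \<open>c\<close>, so the interval from \<open>c\<close> to \<open>d\<close> is non-scattered for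
    \<open>Q\<close>.\<close>
  obtain c where c: "c \<in> A" "contains_dense Q {x\<in>A. strictly_below L c x}"
    using split[OF _ A] by blast
  have "{x\<in>A. strictly_below L c x} \<subseteq> A" by blast
  from split[OF this c(2)] obtain d where d: "d \<in> A" "strictly_below L c d"
    and "contains_dense Q {x \<in> {x\<in>A. strictly_below L c x}. strictly_below L x d}" by blast
  then have "lt c d" unfolding lt_def I_def by (simp add: conj_assoc)
  show ?thesis
  proof (rule dense_relation_not_scattered[OF L, of lt A c d])
    fix x y z assume xy: "lt x y" and yz: "lt y z"
    then have "I x y \<subseteq> I x z" using trL unfolding lt_def I_def by blast
    with xy yz trL show "lt x z" unfolding lt_def by (meson contains_dense_mono)
  next
    fix a b assume "a \<in> A" "b \<in> A" "lt a b"
    then have "contains_dense Q (I a b)" "I a b \<subseteq> A" by (auto simp: lt_def I_def)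
    from split[OF this(2,1)] obtain e where e: "e \<in> I a b"
      "contains_dense Q {x\<in>I a b. strictly_below L x e}"
      "contains_dense Q {x\<in>I a b. strictly_below L e x}" by blast
    have "{x\<in>I a b. strictly_below L x e} \<subseteq> I a e" "{x\<in>I a b. strictly_below L e x} \<subseteq> I e b"
      by (auto simp: I_def)
    with e have "lt a e" "lt e b" unfolding lt_def
      by (auto intro: contains_dense_mono simp: I_def)
    with e(1) show "\<exists>c\<in>A. lt a c \<and> lt c b" by (auto simp: I_def)
  qed (use c(1) d(1) \<open>lt c d\<close> in \<open>auto simp: lt_def\<close>)
qed

text \<open>Without the embeddings, the points of \<open>T\<close> with a \<open>Q\<close>-scattered
  initial segment form a \<open>Q\<close>-scattered set \<open>?I\<close>, and likewise
  \<open>?J\<close> for final segments. Their union cannot exhaust \<open>T\<close>, and any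
  remaining point splits it.\<close>

lemma not_scattered_inter_scattered:
  assumes L: "linear_order_on A L" "scattered A L" and Q: "linear_order_on A Q" "\<not> scattered A Q"
  shows "poset_embeds UNIV Omega_eta A (L \<inter> Q) \<or> poset_embeds UNIV (Omega_eta\<inverse>) A (L \<inter> Q)"
proof (rule ccontr)
  assume no: "\<not> ?thesis"
  have no_init: "\<exists>c\<in>T. contains_dense Q {x\<in>T. (x, c) \<in> L}"
    if "T \<subseteq> A" "contains_dense Q T" for T
    using Omega_eta_embeds[OF L(1) Q(1) that] no by blast
  have no_final: "\<exists>c\<in>T. contains_dense Q {x\<in>T. (c, x) \<in> L}"
    if "T \<subseteq> A" "contains_dense Q T" for T
  proof (rule ccontr)
    assume "\<not> ?thesis"
    \<comment> \<open>Final segments of \<open>L\<close> are initial segments of its converse, so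
      the previous construction applies to both orders reversed.\<close>
    then have "poset_embeds UNIV Omega_eta A (L\<inverse> \<inter> Q\<inverse>)"
      using L(1) Q(1) that by (intro Omega_eta_embeds[of A _ _ T]) (simp_all add: contains_dense_converse)
    then have "poset_embeds UNIV (Omega_eta\<inverse>) A (L \<inter> Q)"
      by (metis converse_Int converse_converse poset_embeds_converse)
    with no show False by blast
  qed
  have drop_point: "contains_dense Q (X - {c})" if "contains_dense Q X" for X c
  proof -
    have "contains_dense Q ((X - {c}) \<union> {c})" by (rule contains_dense_mono[OF that]) blast
    moreover have "\<not> contains_dense Q {c}"
      unfolding contains_dense_def strictly_below_def by blast
    ultimately show ?thesis using contains_dense_Un[OF Q(1)] by blast
  qed
  have "\<not> scattered A L"
  proof (rule not_scattered_if_splitting[OF L(1) Q(1)])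
    show "contains_dense Q A" using Q scattered_iff by blast
    fix T assume T: "T \<subseteq> A" "contains_dense Q T"
    let ?I = "{c\<in>T. \<not> contains_dense Q {x\<in>T. (x, c) \<in> L}}"
    let ?J = "{c\<in>T. \<not> contains_dense Q {x\<in>T. (c, x) \<in> L}}"
    have "\<not> contains_dense Q ?I"
    proof
      assume "contains_dense Q ?I"
      with T(1) obtain c where "c \<in> ?I" and c: "contains_dense Q {x\<in>?I. (x, c) \<in> L}"
        using no_init[of ?I] by blast
      have "contains_dense Q {x\<in>T. (x, c) \<in> L}" by (rule contains_dense_mono[OF c]) blast
      with \<open>c \<in> ?I\<close> show False by blast
    qed
    moreover have "\<not> contains_dense Q ?J"
    proof
      assume "contains_dense Q ?J"
      with T(1) obtain c where "c \<in> ?J" and c: "contains_dense Q {x\<in>?J. (c, x) \<in> L}"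
        using no_final[of ?J] by blast
      have "contains_dense Q {x\<in>T. (c, x) \<in> L}" by (rule contains_dense_mono[OF c]) blast
      with \<open>c \<in> ?J\<close> show False by blast
    qed
    ultimately have "\<not> contains_dense Q (?I \<union> ?J)" using contains_dense_Un[OF Q(1)] by blast
    then obtain c where "c \<in> T" "c \<notin> ?I \<union> ?J" using contains_dense_mono[OF T(2)] by blast
    then have c: "contains_dense Q {x\<in>T. (x, c) \<in> L}" "contains_dense Q {x\<in>T. (c, x) \<in> L}" by blast+
    have "{x\<in>T. (x, c) \<in> L} - {c} = {x\<in>T. strictly_below L x c}"
      "{x\<in>T. (c, x) \<in> L} - {c} = {x\<in>T. strictly_below L c x}"
      by (auto simp: strictly_below_def)
    with drop_point[OF c(1), of c] drop_point[OF c(2), of c] \<open>c \<in> T\<close>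
    show "\<exists>c\<in>T. contains_dense Q {x\<in>T. strictly_below L x c} \<and>
        contains_dense Q {x\<in>T. strictly_below L c x}" by auto
  qed
  with L(2) show False by blast
qed

section \<open>Realizers of the tree\<close>

text \<open>\<open>L2\<close> reverses \<open>L1\<close> on incomparable pairs, so a
  \<open>y\<close> separating \<open>x\<close> from \<open>z\<close> in \<open>L1\<close> would put
  \<open>z\<close> below \<open>y\<close> and \<open>y\<close> below \<open>x\<close> in
  \<open>L2\<close>.\<close>

lemma realizer_not_separating:
  assumes L1: "linear_order_on A L1" and L2: "linear_order_on A L2"
  shows "\<not> separating A (L1 \<inter> L2) L1"
proof
  assume "separating A (L1 \<inter> L2) L1"
  then obtain x y z where "x \<in> A" "y \<in> A" "z \<in> A" "(x, z) \<in> L1 \<inter> L2" "x \<noteq> z"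
    "(x, y) \<notin> L1 \<inter> L2" "(y, z) \<notin> L1 \<inter> L2" "(x, y) \<in> L1" "(y, z) \<in> L1"
    unfolding separating_def strictly_below_def incomparable_def by blast
  moreover from this have "(y, x) \<in> L2" "(z, y) \<in> L2"
    using linear_order_onD(6)[OF L2] by blast+
  then have "(z, x) \<in> L2" by (rule linear_order_onD(4)[OF L2, rotated])
  ultimately show False using linear_order_onD(5)[OF L2] by blast
qed

text \<open>Lets one end of an incomparable pair move to a comparable point without changing the
  direction of the pair in \<open>L\<close>: a change would place \<open>y\<close> strictly between
  \<open>x\<close> and \<open>z\<close>.\<close>

lemma same_side_if_not_separating:
  assumes L: "linear_extension A P L" "\<not> separating A P L"
    and A: "x \<in> A" "y \<in> A" "z \<in> A"
    and P: "(x, z) \<in> P" "incomparable P y x" "incomparable P y z"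
  shows "(x, y) \<in> L \<longleftrightarrow> (z, y) \<in> L"
proof -
  have lin: "linear_order_on A L" and PL: "P \<subseteq> L" using L(1) by (auto simp: linear_extension_def)
  have "(z, y) \<in> L" if "(x, y) \<in> L"
  proof (rule ccontr)
    assume "(z, y) \<notin> L"
    then have "(y, z) \<in> L" "y \<noteq> z" "x \<noteq> z" "x \<noteq> y"
      using linear_order_onD(3,6)[OF lin] A that P unfolding incomparable_def by blast+
    with that A P L(2) show False unfolding separating_def strictly_below_def by blast
  qed
  moreover have "(x, y) \<in> L" if "(z, y) \<in> L"
    using linear_order_onD(4)[OF lin] PL P(1) that by blast
  ultimately show ?thesis ..
qed

text \<open>Together the two conditions make \<open>L\<close> sort the nodes by value, and the
  values are densely ordered.\<close>

lemma not_scattered_if_edges_reversed: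
  assumes L: "linear_order_on A L" and f: "inj f" "range f \<subseteq> A"
    and ext: "\<And>s t. (s, t) \<in> Omega_eta \<Longrightarrow> (f s, f t) \<in> L"
    and edges: "\<And>s t. length s < length t \<Longrightarrow> val t < val s \<Longrightarrow> (f t, f s) \<in> L"
  shows "\<not> scattered A L"
proof -
  have fL: "strictly_below L (f s) (f t)" if "val s < val t" for s t
    using that edges[of t s] ext[of s t] f(1) unfolding Omega_eta_val strictly_below_def
    by (cases "length s \<le> length t") (auto simp: inj_eq)
  \<comment> \<open>Trailing zeros do not change the value, so one node is chosen for each
    value.\<close>
  define c where "c v = f (SOME s. val s = v)" for v
  have c: "strictly_below L (c (val s)) (c (val t)) \<longleftrightarrow> val s < val t" for s t
  proof -
    have "val (SOME u. val u = val w) = val w" for w by (rule someI) simp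
    then have lt: "strictly_below L (c (val s)) (c (val t))" if "val s < val t" for s t
      using that fL unfolding c_def by simp
    show ?thesis
      using lt[of s t] lt[of t s] linear_order_onD(5)[OF L] unfolding strictly_below_def
      by (metis linorder_neqE_linordered_idom)
  qed
  have "contains_dense L A"
  proof (rule contains_denseI[of "c ` range val" _ "c (val [])" "c (val [True])"])
    show "c ` range val \<subseteq> A" using f(2) unfolding c_def by blast
    show "strictly_below L (c (val [])) (c (val [True]))" unfolding c by simp
    fix a b assume "a \<in> c ` range val" "b \<in> c ` range val" "strictly_below L a b"
    then obtain s t where "a = c (val s)" "b = c (val t)" "val s < val t" using c by blast
    moreover from this(3) obtain u where "val s < val u" "val u < val t" by (rule val_dense)
    ultimately show "\<exists>x\<in>c ` range val. strictly_below L a x \<and> strictly_below L x b"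
      using c by blast
  qed (rule imageI rangeI)+
  with scattered_iff[OF L] show ?thesis by blast
qed

text \<open>
  Every edge of the incomparability graph of the tree can be moved, one endpoint at a time and
  within comparable nodes, to one between \<open>1\<^sup>m\<close> and \<open>0\<^sup>N\<close>; since \<open>L1\<close> is non-separating,
  it therefore orders all edges in the same direction.
\<close>

lemma not_scattered_realizer_of_Omega_eta:
  assumes L1: "linear_order_on A L1" and L2: "linear_order_on A L2"
    and emb: "poset_embeds UNIV Omega_eta A (L1 \<inter> L2)"
  shows "\<not> scattered A L1 \<or> \<not> scattered A L2"
proof -
  obtain f where f: "inj f" "range f \<subseteq> A"
    and iff: "\<And>s t. (s, t) \<in> Omega_eta \<longleftrightarrow> (f s, f t) \<in> L1 \<inter> L2"
    using emb by (elim poset_embedsE) auto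
  have fA: "f s \<in> A" for s using f(2) by blast
  have ext: "linear_extension A (L1 \<inter> L2) L1" using L1 by (simp add: linear_extension_def)
  \<comment> \<open>Two nodes are incomparable exactly when the shorter has the larger value;
    \<open>edge\<close> names the shorter first.\<close>
  define edge where "edge s t \<longleftrightarrow> length s < length t \<and> val t < val s" for s t
  have inc: "incomparable (L1 \<inter> L2) (f s) (f t)" "incomparable (L1 \<inter> L2) (f t) (f s)" if "edge s t" for s t
    using that unfolding incomparable_def iff[symmetric] Omega_eta_val edge_def by auto
  have move_right: "(f t, f s) \<in> L1 \<longleftrightarrow> (f t', f s) \<in> L1"
    if "edge s t" "edge s t'" "(t, t') \<in> Omega_eta" for s t t'
    by (rule same_side_if_not_separating[OF ext realizer_not_separating[OF L1 L2]])
      (use that inc iff fA in blast)+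
  have move_left: "(f t, f s) \<in> L1 \<longleftrightarrow> (f t, f s') \<in> L1"
    if e: "edge s t" "edge s' t" "(s, s') \<in> Omega_eta" for s s' t
  proof -
    have "(f s, f t) \<in> L1 \<longleftrightarrow> (f s', f t) \<in> L1"
      by (rule same_side_if_not_separating[OF ext realizer_not_separating[OF L1 L2]])
        (use that inc iff fA in blast)+
    moreover have "(f s, f t) \<in> L1 \<longleftrightarrow> (f t, f s) \<notin> L1" if "edge s t" for s t
      using linear_order_onD(3,5,6)[OF L1] fA inc(1)[OF that] linear_order_onD(3)[OF L2]
      unfolding incomparable_def by (metis IntI)
    ultimately show ?thesis using e by blast
  qed
  have canonical: "(f t, f s) \<in> L1 \<longleftrightarrow> (f (replicate N False), f (replicate m True)) \<in> L1"
    if e: "edge s t" and "length s \<le> m" "length t \<le> N" "m < N" for s t m N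
  proof -
    let ?z = "\<lambda>n. replicate n False" and ?u = "replicate m True"
    have s: "0 < val s" using e val_nonneg[of t] unfolding edge_def by linarith
    have "1 - 1 / 2 ^ length s \<le> 1 - 1 / (2::real) ^ m"
      using \<open>length s \<le> m\<close> by (simp add: frac_le)
    then have su: "val s \<le> val ?u" using val_le[of s] by (simp add: val_replicate)
    \<comment> \<open>The path lowers \<open>t\<close> to the leftmost node of its level, lengthens
      it to \<open>?z N\<close>, then raises \<open>s\<close> to \<open>?u\<close>. Positivity of
      \<open>val s\<close> and \<open>m < N\<close> keep every pair an edge.\<close>
    have "(f t, f s) \<in> L1 \<longleftrightarrow> (f (?z (length t)), f s) \<in> L1"
      by (rule move_right[symmetric])
        (use e s in \<open>auto simp: edge_def Omega_eta_val val_replicate val_nonneg\<close>)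
    also have "\<dots> \<longleftrightarrow> (f (?z N), f s) \<in> L1"
      by (rule move_right)
        (use e s that in \<open>auto simp: edge_def Omega_eta_val val_replicate\<close>)
    also have "\<dots> \<longleftrightarrow> (f (?z N), f ?u) \<in> L1"
    proof (rule move_left)
      show "edge s (?z N)" "(s, ?u) \<in> Omega_eta"
        using e s su that by (auto simp: edge_def Omega_eta_val val_replicate)
      have "0 < val ?u" using s su by linarith
      then show "edge ?u (?z N)" using that by (simp add: edge_def val_replicate)
    qed
    finally show ?thesis .
  qed
  have same: "(f t, f s) \<in> L1 \<longleftrightarrow> (f t', f s') \<in> L1" if "edge s t" "edge s' t'" for s t s' t'
    \<comment> \<open>The sums of lengths bound both edges at once and keep the required strict
      inequality.\<close>
    using canonical[OF that(1), of "length s + length s'" "length t + length t'"]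
      canonical[OF that(2), of "length s + length s'" "length t + length t'"] that
    by (simp add: edge_def)
  show ?thesis
  proof (cases "\<forall>s t. edge s t \<longrightarrow> (f t, f s) \<in> L1")
    case True
    then have "\<not> scattered A L1"
      by (intro not_scattered_if_edges_reversed[OF L1 f]) (auto simp: edge_def iff)
    then show ?thesis ..
  next
    case False
    then have no: "(f t, f s) \<notin> L1" if "edge s t" for s t using same that by blast
    \<comment> \<open>An edge not reversed by \<open>L1\<close> follows the length there, so
      incomparability makes \<open>L2\<close> reverse it.\<close>
    have "(f t, f s) \<in> L2" if "edge s t" for s t
      using no[OF that] inc(1)[OF that] fA linear_order_onD(6)[OF L1] linear_order_onD(6)[OF L2]
      unfolding incomparable_def by blast
    then have "\<not> scattered A L2"
      by (intro not_scattered_if_edges_reversed[OF L2 f]) (auto simp: edge_def iff)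
    then show ?thesis ..
  qed
qed

section \<open>The complementary linear order of a non-separating extension\<close>

text \<open>The conjugate order of Dushnik and Miller. As \<open>L2\<close> is total, a failure of
  transitivity is a 3-cycle; \<open>no_cycle\<close> excludes one with a pair in \<open>P\<close>,
  and one without would be a cycle in \<open>L\<close>.\<close>

lemma linear_order_reverse_incomparable:
  assumes P: "partial_order_on A P" and L: "linear_extension A P L" "\<not> separating A P L"
  defines "L2 \<equiv> P \<union> {(x, y) \<in> A \<times> A. incomparable P x y \<and> (y, x) \<in> L}"
  shows "linear_order_on A L2" "P = L \<inter> L2"
proof -
  have lin: "linear_order_on A L" and PL: "P \<subseteq> L" using L(1) by (auto simp: linear_extension_def)
  have PA: "P \<subseteq> A \<times> A" and Prefl: "\<And>x. x \<in> A \<Longrightarrow> (x, x) \<in> P"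
    and Ptr: "\<And>x y z. (x, y) \<in> P \<Longrightarrow> (y, z) \<in> P \<Longrightarrow> (x, z) \<in> P"
    using P unfolding order_on_defs refl_on_def by (auto elim: transE)
  have inc_iff: "(x, y) \<in> L2 \<longleftrightarrow> (y, x) \<in> L" if "incomparable P x y" "x \<in> A" "y \<in> A" for x y
    using that unfolding L2_def incomparable_def by blast
  have total: "(x, y) \<in> L2 \<or> (y, x) \<in> L2" if "x \<in> A" "y \<in> A" for x y
    using that linear_order_onD(6)[OF lin that] unfolding L2_def incomparable_def by blast
  have antisym: "x = y" if "(x, y) \<in> L2" "(y, x) \<in> L2" for x y
    using that linear_order_onD(5)[OF lin] PL unfolding L2_def incomparable_def by blast
  note side = same_side_if_not_separating[OF L]
  have no_cycle: "x = y \<or> y = z \<or> z = x" if xy: "(x, y) \<in> P" and L2: "(y, z) \<in> L2" "(z, x) \<in> L2" for x y z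
  proof (rule ccontr)
    assume ne: "\<not> ?thesis"
    have A: "x \<in> A" "y \<in> A" "z \<in> A" using that PA unfolding L2_def by auto
    consider "(y, z) \<in> P" | "(z, x) \<in> P" | "incomparable P y z" "incomparable P z x"
      using L2 unfolding L2_def by blast
    then show False
    proof cases
      case 1
      then have "(x, z) \<in> L2" using Ptr xy unfolding L2_def by blast
      with that ne antisym show False by blast
    next
      case 2
      then have "(z, y) \<in> L2" using Ptr xy unfolding L2_def by blast
      with that ne antisym show False by blast
    next
      case 3
      \<comment> \<open>Here \<open>z\<close> would lie strictly between \<open>x\<close> and
        \<open>y\<close> in \<open>L\<close> while incomparable to both, which is
        separation.\<close>
      then have "(z, y) \<in> L" "(x, z) \<in> L" using that A inc_iff by blast+
      moreover have "incomparable P z y" using 3 unfolding incomparable_def by blast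
      ultimately have "(z, y) \<in> L" "(y, z) \<in> L" using side[OF A(1,3,2) xy] 3 by blast+
      with ne linear_order_onD(5)[OF lin] show False by blast
    qed
  qed
  have "trans L2"
  proof (rule transI, rule ccontr)
    fix x y z assume xy: "(x, y) \<in> L2" and yz: "(y, z) \<in> L2" and n: "(x, z) \<notin> L2"
    have A: "x \<in> A" "y \<in> A" "z \<in> A" using xy yz PA unfolding L2_def by auto
    with total n have zx: "(z, x) \<in> L2" by blast
    have ne: "x \<noteq> y" "y \<noteq> z" "z \<noteq> x" using xy yz n Prefl A unfolding L2_def by auto
    then have "(x, y) \<notin> P" "(y, z) \<notin> P" "(z, x) \<notin> P"
      using no_cycle[of x y z] no_cycle[of y z x] no_cycle[of z x y] xy yz zx by blast+
    then have "(y, x) \<in> L" "(z, y) \<in> L" "(x, z) \<in> L" using xy yz zx unfolding L2_def by blast+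
    with ne linear_order_onD(4,5)[OF lin] show False by blast
  qed
  moreover have "antisym L2" using antisym by (rule antisymI)
  moreover have "L2 \<subseteq> A \<times> A" "refl_on A L2" using PA Prefl unfolding L2_def refl_on_def by blast+
  moreover have "total_on A L2" using total unfolding total_on_def by blast
  ultimately show "linear_order_on A L2" unfolding order_on_defs by blast
  show "P = L \<inter> L2"
    using PL Prefl linear_order_onD(5)[OF lin] unfolding L2_def incomparable_def by blast
qed

theorem theorem13:
  fixes A :: "'a set" and P :: "'a rel"
  assumes "partial_order_on A P"
  shows "(\<exists>L1 L2. linear_order_on A L1 \<and> scattered A L1 \<and>
                  linear_order_on A L2 \<and> scattered A L2 \<and> P = L1 \<inter> L2)
     \<longleftrightarrow>
         (\<exists>L. linear_extension A P L \<and> scattered A L \<and> \<not> separating A P L) \<and>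
         \<not> poset_embeds UNIV Omega_eta A P \<and>
         \<not> poset_embeds UNIV (Omega_eta\<inverse>) A P"
    (is "?lhs \<longleftrightarrow> ?rhs")
proof
  assume ?lhs
  then obtain L1 L2 where L: "linear_order_on A L1" "scattered A L1"
    "linear_order_on A L2" "scattered A L2" and P: "P = L1 \<inter> L2" by blast
  have "linear_extension A P L1" using L(1) P by (simp add: linear_extension_def)
  moreover have "\<not> separating A P L1" unfolding P by (rule realizer_not_separating[OF L(1,3)])
  moreover have "\<not> poset_embeds UNIV Omega_eta A P"
    using not_scattered_realizer_of_Omega_eta[OF L(1,3)] L(2,4) P by blast
  moreover have "\<not> poset_embeds UNIV (Omega_eta\<inverse>) A P"
  proof
    assume "poset_embeds UNIV (Omega_eta\<inverse>) A P"
    \<comment> \<open>Reversing both orders preserves scatteredness and exchanges the tree with its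
      dual.\<close>
    then have "poset_embeds UNIV Omega_eta A (L1\<inverse> \<inter> L2\<inverse>)"
      unfolding P by (metis converse_Int converse_converse poset_embeds_converse)
    then show False
      using not_scattered_realizer_of_Omega_eta[of A "L1\<inverse>" "L2\<inverse>"] L by (simp add: scattered_converse)
  qed
  ultimately show ?rhs using L(2) by blast
next
  assume rhs: ?rhs
  then obtain L where L: "linear_extension A P L" "scattered A L" "\<not> separating A P L" by blast
  obtain L2 where L2: "linear_order_on A L2" "P = L \<inter> L2"
    using linear_order_reverse_incomparable[OF assms L(1,3)] by blast
  have "linear_order_on A L" using L(1) by (simp add: linear_extension_def)
  moreover from this have "scattered A L2"
    using not_scattered_inter_scattered[of A L L2] L(2) L2 rhs by blast
  ultimately show ?lhs using L(2) L2 by blast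
qed

end
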